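(* Let $G$ be a periodic locally compact abelian group. Then $G$ is topologically modular if and only if for every prime $p$ the $p$-primary component $G_p$ of $G$ is topologically modular.
   Context: All topological groups are Hausdorff; abelian groups are written additively. A locally compact abelian (LCA) group is periodic if it is totally disconnected and the union of its compact subgroups. For a prime $p$, an element $x$ of an LCA group is a $p$-element if $p^kx\to 0$ as $k\to\infty$; in a periodic LCA group $G$ the $p$-elements form a closed subgroup $G_p$, the $p$-primary component. For closed subgroups $A,B$ of an LCA group $G$ put $A\vee B=\overline{A+B}$ and $A\wedge B=A\cap B$. $G$ is topologically modular if $A\vee(B\wedge C)=(A\vee B)\wedge C$ for all closed subgroups $A,B,C$ of $G$ with $A\subseteq C$. *)

theory Defs
  imports "HOL-Analysis.Analysis" "HOL-Library.Cancellation" "HOL-Computational_Algebra.Primes"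
begin

text \<open>
  A Hausdorff topological abelian group is a type of sort
  \<open>{topological_ab_group_add, t2_space}\<close>. Subgroups are subsets of such a type, carrying the
  subspace topology; the whole group is \<^term>\<open>UNIV\<close>.
\<close>

definition add_subgroup :: "'a::ab_group_add set \<Rightarrow> bool" where
  "add_subgroup H \<longleftrightarrow> 0 \<in> H \<and> (\<forall>x\<in>H. \<forall>y\<in>H. x + y \<in> H) \<and> (\<forall>x\<in>H. - x \<in> H)"

definition totally_disconnected :: "'a::topological_space set \<Rightarrow> bool" where
  "totally_disconnected S \<longleftrightarrow> (\<forall>x\<in>S. connected_component_set S x = {x})"

text \<open>Local compactness is not part of this predicate.\<close>

definition periodic :: "'a::topological_ab_group_add set \<Rightarrow> bool" where
  "periodic G \<longleftrightarrow>
     totally_disconnected G \<and> G = \<Union>{K. K \<subseteq> G \<and> add_subgroup K \<and> compact K}"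

text \<open>\<^term>\<open>iterate_add n x\<close> is the \<open>n\<close>-fold sum \<open>x + \<dots> + x\<close>.\<close>

definition p_element :: "nat \<Rightarrow> 'a::topological_ab_group_add \<Rightarrow> bool" where
  "p_element p x \<longleftrightarrow> (\<lambda>k. iterate_add (p ^ k) x) \<longlonglongrightarrow> 0"

definition primary_component :: "nat \<Rightarrow> 'a::topological_ab_group_add set" where
  "primary_component p = {x. p_element p x}"

definition closed_subgroup_of ::
    "'a::topological_ab_group_add set \<Rightarrow> 'a set \<Rightarrow> bool" where
  "closed_subgroup_of G A \<longleftrightarrow> add_subgroup A \<and> closedin (top_of_set G) A"

text \<open>
  The join of \<open>A\<close> and \<open>B\<close> in \<open>G\<close>: the closure, relative to \<open>G\<close>, of the pointwise sum of the
  two sets. The meet is plain intersection.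
\<close>

definition closed_join ::
    "'a::topological_ab_group_add set \<Rightarrow> 'a set \<Rightarrow> 'a set \<Rightarrow> 'a set" where
  "closed_join G A B = (top_of_set G) closure_of (A + B)"

definition topologically_modular :: "'a::topological_ab_group_add set \<Rightarrow> bool" where
  "topologically_modular G \<longleftrightarrow>
     (\<forall>A B C. closed_subgroup_of G A \<and> closed_subgroup_of G B \<and> closed_subgroup_of G C \<and> A \<subseteq> C
        \<longrightarrow> closed_join G A (B \<inter> C) = closed_join G A B \<inter> C)"

lemma closed_subgroup_of_UNIV: "closed_subgroup_of UNIV A \<longleftrightarrow> add_subgroup A \<and> closed A"
  by (simp add: closed_subgroup_of_def)

lemma closed_join_UNIV: "closed_join UNIV A B = closure (A + B)"
  by (simp add: closed_join_def)

lemma iterate_add_plus: "iterate_add n (x + y) = iterate_add n x + iterate_add n (y::'a::ab_group_add)"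
  by (induction n) (simp_all add: iterate_add_def algebra_simps)

lemma iterate_add_minus: "iterate_add n (- x) = - iterate_add n (x::'a::ab_group_add)"
  by (induction n) (simp_all add: iterate_add_def)

lemma iterate_add_zero: "iterate_add n (0::'a::ab_group_add) = 0"
  by (induction n) (simp_all add: iterate_add_def)

lemma add_subgroup_primary_component:
  "add_subgroup (primary_component p :: 'a::topological_ab_group_add set)"
proof -
  have "p_element p (x + y)" if "p_element p x" "p_element p y" for x y :: 'a
    using tendsto_add[OF that[unfolded p_element_def]]
    by (simp add: p_element_def iterate_add_plus)
  moreover have "p_element p (- x)" if "p_element p x" for x :: 'a
    using tendsto_minus[OF that[unfolded p_element_def]]
    by (simp add: p_element_def iterate_add_minus)
  moreover have "p_element p (0::'a)"
    by (simp add: p_element_def iterate_add_zero)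
  ultimately show ?thesis
    by (simp add: add_subgroup_def primary_component_def)
qed

end

theory Submission
  imports Defs "HOL-Number_Theory.Cong"
begin

text \<open>
  In a periodic group the integers that are \<open>1\<close> modulo the \<open>p\<close>-part of \<open>k!\<close> and \<open>0\<close> modulo
  the remaining part act, for \<open>k \<rightarrow> \<infinity>\<close>, as an idempotent of the profinite integers. This gives a
  continuous projection \<open>\<pi>\<^sub>p\<close> of \<open>G\<close> onto \<open>G\<^sub>p\<close> which maps every closed subgroup
  \<open>H\<close> into itself, hence onto \<open>H \<inter> G\<^sub>p\<close>. Moreover \<open>x\<close> lies in every closed subgroup that
  contains all \<open>\<pi>\<^sub>p x\<close>. So \<open>(A \<or> B) \<inter> G\<^sub>p\<close> is the join of \<open>A \<inter> G\<^sub>p\<close> and \<open>B \<inter> G\<^sub>p\<close>, and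
  the modular law can be verified on the primary components separately.
\<close>

section \<open>Integers approximating the idempotents\<close>

text \<open>For prime \<open>p\<close> and \<open>m > 0\<close> a solution is unique only modulo
  \<open>m\<close>; \<open>SOME\<close> picks any, so everything proved about it is a congruence or
  a divisibility.\<close>

definition crt_unit :: "nat \<Rightarrow> nat \<Rightarrow> nat" where
  "crt_unit p m = (SOME n. [n = 1] (mod p ^ multiplicity p m) \<and>
                           [n = 0] (mod m div p ^ multiplicity p m))"

lemma coprime_prime_part:
  fixes p m :: nat
  assumes "prime p" "m > 0"
  shows "coprime (p ^ n) (m div p ^ multiplicity p m)"
proof -
  have "\<not> p dvd m div p ^ multiplicity p m"
    using assms by (intro multiplicity_decompose) auto
  then show ?thesis
    using assms(1) by (simp add: prime_imp_coprime)
qed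

lemma crt_unit:
  assumes "prime p" "m > 0"
  shows "[crt_unit p m = 1] (mod p ^ multiplicity p m)"
    and "[crt_unit p m = 0] (mod m div p ^ multiplicity p m)"
proof -
  have "\<exists>n. [n = 1] (mod p ^ multiplicity p m) \<and> [n = 0] (mod m div p ^ multiplicity p m)"
    using binary_chinese_remainder_nat[OF coprime_prime_part[OF assms]] .
  from someI_ex[OF this, folded crt_unit_def]
  show "[crt_unit p m = 1] (mod p ^ multiplicity p m)"
    and "[crt_unit p m = 0] (mod m div p ^ multiplicity p m)"
    by auto
qed

lemma prime_part_mult:
  fixes p m :: nat
  shows "p ^ multiplicity p m * (m div p ^ multiplicity p m) = m"
  by (simp add: multiplicity_dvd)

text \<open>Both the \<open>p\<close>-part and the \<open>p\<close>-free part of \<open>m\<close>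
  divide those of \<open>M\<close>, so the two defining congruences at \<open>M\<close> restrict to
  those at \<open>m\<close>. This is the compatibility that makes the values converge
  profinitely.\<close>

lemma crt_unit_cong:
  assumes "prime p" "m dvd M" "M > 0"
  shows "[crt_unit p M = crt_unit p m] (mod m)"
proof -
  have m: "m > 0"
    using assms by (auto intro: Nat.gr0I)
  let ?a = "p ^ multiplicity p m" and ?A = "p ^ multiplicity p M"
  have a: "?a dvd ?A"
    using assms by (intro le_imp_power_dvd dvd_imp_multiplicity_le) auto
  \<comment> \<open>The product is \<open>M\<close>. Being coprime to the \<open>p\<close>-part
    \<open>?A\<close>, the divisor must then divide the other factor.\<close>
  have "m div ?a dvd ?A * (M div ?A)"
    unfolding prime_part_mult
    by (metis assms(2) dvd_trans dvd_triv_right prime_part_mult)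
  moreover have "coprime (m div ?a) ?A"
    using coprime_prime_part[OF assms(1) m] by (simp add: coprime_commute)
  ultimately have b: "m div ?a dvd M div ?A"
    by (simp add: coprime_dvd_mult_right_iff)
  have "[crt_unit p M = crt_unit p m] (mod ?a)"
    using cong_dvd_modulus_nat[OF crt_unit(1)[OF assms(1,3)] a] crt_unit(1)[OF assms(1) m]
    by (meson cong_sym cong_trans)
  moreover have "[crt_unit p M = crt_unit p m] (mod m div ?a)"
    using cong_dvd_modulus_nat[OF crt_unit(2)[OF assms(1,3)] b] crt_unit(2)[OF assms(1) m]
    by (meson cong_sym cong_trans)
  ultimately show ?thesis
    using coprime_cong_mult_nat[OF _ _ coprime_prime_part[OF assms(1) m]]
    by (metis prime_part_mult)
qed

lemma crt_unit_other_prime: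
  assumes "prime p" "prime q" "p \<noteq> q" "m > 0"
  shows "q ^ multiplicity q m dvd crt_unit p m"
proof -
  have "coprime (q ^ multiplicity q m) (p ^ multiplicity p m)"
    using assms by (simp add: primes_coprime)
  moreover have "q ^ multiplicity q m dvd p ^ multiplicity p m * (m div p ^ multiplicity p m)"
    by (simp only: prime_part_mult multiplicity_dvd)
  ultimately have "q ^ multiplicity q m dvd m div p ^ multiplicity p m"
    by (simp add: coprime_dvd_mult_right_iff)
  also have "\<dots> dvd crt_unit p m"
    using crt_unit(2)[OF assms(1,4)] by (simp add: cong_0_iff)
  finally show ?thesis .
qed

text \<open>The idempotents sum to 1: modulo the \<open>q\<close>-part of \<open>m\<close> only the
  summand for \<open>q\<close> survives, and it is 1 there. The prime power parts are pairwise
  coprime with product \<open>m\<close>.\<close>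

lemma sum_crt_unit:
  assumes "m > 0"
  shows "[(\<Sum>p\<in>prime_factors m. crt_unit p m) = 1] (mod m)"
proof -
  have "[(\<Sum>p\<in>prime_factors m. crt_unit p m) = 1] (mod (\<Prod>q\<in>prime_factors m. q ^ multiplicity q m))"
  proof (rule coprime_cong_prod_nat)
    fix q r assume "q \<in> prime_factors m" "r \<in> prime_factors m" "q \<noteq> r"
    then show "coprime (q ^ multiplicity q m) (r ^ multiplicity r m)"
      by (auto intro!: primes_coprime)
  next
    fix q assume q: "q \<in> prime_factors m"
    then have "prime q" by auto
    have "q ^ multiplicity q m dvd (\<Sum>p\<in>prime_factors m - {q}. crt_unit p m)"
      using \<open>prime q\<close> assms by (intro dvd_sum crt_unit_other_prime) auto
    then have "[crt_unit q m + (\<Sum>p\<in>prime_factors m - {q}. crt_unit p m) = 1 + 0]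
        (mod q ^ multiplicity q m)"
      using crt_unit(1)[OF \<open>prime q\<close> assms] by (intro cong_add) (auto simp: cong_0_iff)
    then show "[(\<Sum>p\<in>prime_factors m. crt_unit p m) = 1] (mod q ^ multiplicity q m)"
      using q by (simp add: sum.remove[of _ q])
  qed
  then show ?thesis
    using assms prime_factorization_nat[of m] by simp
qed

text \<open>The power of \<open>p\<close> absorbs the \<open>p\<close>-part of \<open>m\<close>, and
  \<open>crt_unit p m\<close> the rest. This will make the values of the projection
  \<open>p\<close>-elements.\<close>

lemma dvd_power_mult_crt_unit:
  assumes "prime p" "m > 0" "multiplicity p m \<le> j"
  shows "m dvd p ^ j * crt_unit p m"
proof -
  have "p ^ multiplicity p m * (m div p ^ multiplicity p m) dvd p ^ j * crt_unit p m"
    using assms crt_unit(2)[OF assms(1,2)]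
    by (intro mult_dvd_mono le_imp_power_dvd) (auto simp: cong_0_iff)
  then show ?thesis
    by (simp only: prime_part_mult)
qed

lemma crt_unit_prime_power:
  assumes "prime p"
  shows "[crt_unit p (p ^ a) = 1] (mod p ^ a)"
  using crt_unit(1)[OF assms, of "p ^ a"] assms by (simp add: prime_gt_0_nat)

section \<open>Open subgroups\<close>

lemma add_subgroupD:
  assumes "add_subgroup H"
  shows "0 \<in> H" "x \<in> H \<Longrightarrow> y \<in> H \<Longrightarrow> x + y \<in> H" "x \<in> H \<Longrightarrow> - x \<in> H"
    and "x \<in> H \<Longrightarrow> y \<in> H \<Longrightarrow> x - y \<in> H"
  using assms unfolding add_subgroup_def by (auto simp: diff_conv_add_uminus simp del: add_uminus_conv_diff)

lemma add_subgroup_sum: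
  assumes "add_subgroup H" "\<And>i. i \<in> I \<Longrightarrow> f i \<in> H"
  shows "sum f I \<in> H"
  using assms(2) by (induction I rule: infinite_finite_induct) (auto intro: add_subgroupD[OF assms(1)])

lemma add_subgroup_iterate_add:
  assumes "add_subgroup H" "x \<in> H"
  shows "iterate_add n x \<in> H"
  using assms(2) by (induction n) (auto intro: add_subgroupD[OF assms(1)])

lemma add_subgroup_Int: "add_subgroup H \<Longrightarrow> add_subgroup K \<Longrightarrow> add_subgroup (H \<inter> K)"
  by (auto simp: add_subgroup_def)

lemma iterate_add_mult: "iterate_add (m * n) x = iterate_add m (iterate_add n x)"
  by (induction m) simp_all

lemma iterate_add_sum: "iterate_add (sum f I) x = (\<Sum>i\<in>I. iterate_add (f i) x)"
  by (induction I rule: infinite_finite_induct) simp_all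

text \<open>The class of \<open>x\<close> modulo \<open>H\<close> is killed by \<open>m\<close>, so
  a coefficient matters only modulo \<open>m\<close>.\<close>

lemma iterate_add_cong:
  fixes x :: "'a::ab_group_add"
  assumes H: "add_subgroup H" and m: "iterate_add m x \<in> H" and "[a = b] (mod m)"
  shows "iterate_add a x - iterate_add b x \<in> H"
proof -
  \<comment> \<open>Over the naturals the congruence is written with multiples of \<open>m\<close>
    on both sides, so that no truncated subtraction occurs.\<close>
  obtain k l where kl: "b + k * m = a + l * m"
    using assms(3) by (auto simp: cong_iff_lin_nat)
  have "iterate_add b x + iterate_add (k * m) x = iterate_add a x + iterate_add (l * m) x"
    using kl by (metis iterate_add_distrib)
  then have "iterate_add a x - iterate_add b x = iterate_add (k * m) x - iterate_add (l * m) x"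
    by (simp add: algebra_simps)
  then show ?thesis
    unfolding iterate_add_mult
    using H m by (simp add: add_subgroupD add_subgroup_iterate_add)
qed

lemma open_translate:
  fixes U :: "'a::topological_ab_group_add set"
  assumes "open U"
  shows "open {y. y - x \<in> U}"
proof -
  have "open ((\<lambda>y. y + (- x)) -` U)"
    by (rule open_vimage[OF assms]) (intro continuous_on_add continuous_on_id continuous_on_const)
  then show ?thesis
    by (simp add: vimage_def)
qed

text \<open>The complement is a union of cosets, each of them open.\<close>

lemma open_subgroup_imp_closed:
  fixes U :: "'a::topological_ab_group_add set"
  assumes "open U" "add_subgroup U"
  shows "closed U"
proof -
  have "- U = (\<Union>x\<in>-U. {y. y - x \<in> U})"
  proof (intro set_eqI iffI)
    fix z assume "z \<in> (\<Union>x\<in>-U. {y. y - x \<in> U})"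
    then obtain x where "x \<notin> U" "z - x \<in> U" by auto
    then show "z \<in> - U"
      using add_subgroupD(4)[OF assms(2), of z "z - x"] by auto
  next
    fix z assume "z \<in> - U"
    moreover have "z - z \<in> U"
      using add_subgroupD(1)[OF assms(2)] by simp
    ultimately show "z \<in> (\<Union>x\<in>-U. {y. y - x \<in> U})"
      by blast
  qed
  moreover have "open (\<Union>x\<in>-U. {y. y - x \<in> U})"
    using open_translate[OF assms(1)] by blast
  ultimately show ?thesis
    by (simp add: closed_def)
qed

text \<open>Without first countability a sequence in a compact set may have no convergent
  subsequence; a cluster point of its image filter always exists and suffices here.\<close>

lemma compact_imp_cluster_point:
  fixes f :: "nat \<Rightarrow> 'a::topological_space"
  assumes "compact K" "\<And>n. f n \<in> K"
  obtains y where "y \<in> K" "\<And>T N. open T \<Longrightarrow> y \<in> T \<Longrightarrow> \<exists>n\<ge>N. f n \<in> T"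
proof -
  have "\<exists>y\<in>K. inf (nhds y) (filtermap f sequentially) \<noteq> bot"
    using assms unfolding compact_filter by (simp add: filtermap_bot_iff eventually_filtermap)
  then obtain y where y: "y \<in> K" "inf (nhds y) (filtermap f sequentially) \<noteq> bot"
    by blast
  have "\<exists>n\<ge>N. f n \<in> T" if T: "open T" "y \<in> T" for T N
  proof (rule ccontr)
    assume "\<not> ?thesis"
    then have "eventually (\<lambda>z. z \<notin> T) (filtermap f sequentially)"
      by (auto simp: eventually_filtermap eventually_sequentially)
    moreover have "eventually (\<lambda>z. z \<in> T) (nhds y)"
      using T by (rule eventually_nhds_in_open)
    ultimately have "eventually (\<lambda>z. False) (inf (nhds y) (filtermap f sequentially))"
      unfolding eventually_inf by blast
    with y show False
      by (simp add: trivial_limit_def)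
  qed
  with y(1) show thesis
    using that by blast
qed

text \<open>Two different multiples of \<open>x\<close> fall into the same coset of
  \<open>U\<close>, namely that of a cluster point \<open>y\<close> of all multiples; their
  difference lies in \<open>U\<close>.\<close>

lemma multiple_in_open_subgroup:
  fixes x :: "'a::topological_ab_group_add"
  assumes K: "compact K" "add_subgroup K" "x \<in> K" and U: "open U" "add_subgroup U"
  obtains m where "m > 0" "iterate_add m x \<in> U"
proof -
  obtain y where "\<And>T N. open T \<Longrightarrow> y \<in> T \<Longrightarrow> \<exists>n\<ge>N. iterate_add n x \<in> T"
    using compact_imp_cluster_point[OF K(1), of "\<lambda>n. iterate_add n x"] add_subgroup_iterate_add[OF K(2,3)]
    by metis
  from this[OF open_translate[OF U(1), of y]]
  have late: "\<exists>n\<ge>N. iterate_add n x - y \<in> U" for N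
    using add_subgroupD(1)[OF U(2)] by simp
  obtain a where a: "iterate_add a x - y \<in> U"
    using late[of 0] by auto
  \<comment> \<open>Starting from \<open>Suc a\<close> makes the coefficient \<open>b - a\<close>
    positive.\<close>
  obtain b where b: "b \<ge> Suc a" "iterate_add b x - y \<in> U"
    using late[of "Suc a"] by auto
  have "iterate_add b x - y - (iterate_add a x - y) \<in> U"
    by (intro add_subgroupD[OF U(2)] a b)
  also have "iterate_add b x - y - (iterate_add a x - y) = iterate_add (b - a) x"
    using iterate_add_distrib[of "b - a" a x] b(1) by (simp add: algebra_simps)
  finally show thesis
    using that[of "b - a"] b(1) by auto
qed

text \<open>The stabilizer of a compact open neighbourhood of \<open>0\<close> is an open subgroup inside it.\<close>

lemma van_Dantzig:
  fixes W :: "'a::{topological_ab_group_add, t2_space} set"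
  assumes lc: "locally_compact_space (euclidean :: 'a topology)"
    and td: "totally_disconnected (UNIV :: 'a set)"
    and W: "open W" "0 \<in> W"
  obtains U where "open U" "add_subgroup U" "U \<subseteq> W"
proof -
  obtain V K where V: "open V" "0 \<in> V" "V \<subseteq> K" and K: "compact (K :: 'a set)"
    using lc unfolding locally_compact_space_def
    by (metis UNIV_I compactin_euclidean_iff open_openin topspace_euclidean)
  have eq: "connected_component_of_set euclidean (0::'a) = {0}"
  proof -
    have "connected_component_of euclidean = connected_component (UNIV :: 'a set)"
      by (intro ext) (simp add: connected_component_of_def connected_component_def)
    then show ?thesis
      using td by (simp add: totally_disconnected_def)
  qed
  have comp: "{0::'a} \<in> connected_components_of euclidean"
    using eq unfolding connected_components_of_def by (metis UNIV_I imageI topspace_euclidean)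
  have "Hausdorff_space (euclidean :: 'a topology)"
    by (simp add: Hausdorff_space_def disjnt_def) (metis hausdorff)
  \<comment> \<open>The component of 0 is a single point, hence compact, so it can be separated from
    the complement of \<open>V \<inter> W\<close> by a clopen set \<open>C\<close>.\<close>
  from wilder_locally_compact_component_thm[OF lc this comp, of "V \<inter> W"]
  obtain C D where CD: "open C" "open D" "disjnt C D" "C \<union> D = (UNIV :: 'a set)" "0 \<in> C" "C \<subseteq> V \<inter> W"
    using V W by auto
  have "C = - D"
    using CD unfolding disjnt_def by auto
  then have "closed C"
    using CD(2) by (simp add: closed_Compl)
  then have "compact (K \<inter> C)"
    using K by (simp add: compact_Int_closed)
  moreover have "K \<inter> C = C"
    using CD V by auto
  ultimately have "compact C" by simp
  \<comment> \<open>Compactness of \<open>C\<close> yields, by the tube lemma, one neighbourhood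
    \<open>X\<close> of 0 with \<open>X + C\<close> inside \<open>C\<close>.\<close>
  let ?T = "(\<lambda>z. fst z + snd z) -` C :: ('a \<times> 'a) set"
  have "open ?T"
    by (rule open_vimage[OF CD(1)]) (intro continuous_intros)
  moreover have "{0} \<times> C \<subseteq> ?T" by auto
  ultimately have "\<exists>X. 0 \<in> X \<and> open X \<and> X \<times> C \<subseteq> ?T"
    by (rule Elementary_Topology.tube_lemma[OF \<open>compact C\<close>])
  then obtain X where X: "0 \<in> X" "open X" "X \<times> C \<subseteq> ?T"
    by blast
  define U where "U = {g. \<forall>c. g + c \<in> C \<longleftrightarrow> c \<in> C}"
  have U: "add_subgroup U"
    unfolding add_subgroup_def
  proof (intro conjI ballI)
    show "0 \<in> U" by (simp add: U_def)
    show "x + y \<in> U" if "x \<in> U" "y \<in> U" for x y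
      using that by (auto simp: U_def add.assoc)
    show "- x \<in> U" if "x \<in> U" for x
      unfolding U_def
    proof safe
      fix c
      have "x + (- x + c) \<in> C \<longleftrightarrow> - x + c \<in> C"
        using that unfolding U_def by blast
      then show "- x + c \<in> C \<Longrightarrow> c \<in> C" "c \<in> C \<Longrightarrow> - x + c \<in> C"
        by auto
    qed
  qed
  \<comment> \<open>On the symmetric part of \<open>X\<close> both \<open>g\<close> and
    \<open>- g\<close> map \<open>C\<close> into itself, so \<open>g\<close> stabilizes
    \<open>C\<close>.\<close>
  have N: "X \<inter> uminus -` X \<subseteq> U"
  proof
    fix g assume g: "g \<in> X \<inter> uminus -` X"
    have "g + c \<in> C" if "c \<in> C" for c
      using X(3) g that by auto
    moreover have "- g + c \<in> C" if "c \<in> C" for c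
      using X(3) g that by auto
    ultimately have "g + c \<in> C \<longleftrightarrow> c \<in> C" for c
      by (metis minus_add_cancel)
    then show "g \<in> U" by (simp add: U_def)
  qed
  have "open (uminus -` X)"
    by (rule open_vimage[OF X(2)]) (intro continuous_intros)
  then have "open (X \<inter> uminus -` X)"
    using X(2) by blast
  \<comment> \<open>A subgroup containing a neighbourhood of 0 contains a translate of it around
    each of its points.\<close>
  have "\<exists>T. open T \<and> x \<in> T \<and> T \<subseteq> U" if "x \<in> U" for x
  proof (intro exI conjI)
    show "open {y. y - x \<in> X \<inter> uminus -` X}"
      by (rule open_translate) fact
    show "x \<in> {y. y - x \<in> X \<inter> uminus -` X}"
      using X(1) by simp
    show "{y. y - x \<in> X \<inter> uminus -` X} \<subseteq> U"
    proof
      fix y assume "y \<in> {y. y - x \<in> X \<inter> uminus -` X}"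
      then have "y - x \<in> U" using N by blast
      then show "y \<in> U"
        using add_subgroupD(2)[OF U \<open>y - x \<in> U\<close> that] by simp
    qed
  qed
  then have "open U"
    by (subst open_subopen) blast
  moreover have "U \<subseteq> W"
  proof
    fix g assume "g \<in> U"
    then have "g + 0 \<in> C" using CD(5) unfolding U_def by blast
    then show "g \<in> W" using CD(6) by auto
  qed
  ultimately show thesis using that U by blast
qed

section \<open>Sums and closures of subgroups\<close>

lemma add_subgroup_plus:
  assumes "add_subgroup A" "add_subgroup B"
  shows "add_subgroup (A + B)"
  unfolding add_subgroup_def
proof (intro conjI ballI)
  show "0 \<in> A + B"
    using set_plus_intro[of 0 A 0 B] assms by (simp add: add_subgroupD)
next
  fix x y assume "x \<in> A + B" "y \<in> A + B"
  then obtain a b c d where *: "x = a + b" "y = c + d" "a \<in> A" "b \<in> B" "c \<in> A" "d \<in> B"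
    by (auto elim!: set_plus_elim)
  then have "(a + c) + (b + d) \<in> A + B"
    by (intro set_plus_intro add_subgroupD(2)[OF assms(1)] add_subgroupD(2)[OF assms(2)])
  then show "x + y \<in> A + B"
    using * by (simp add: algebra_simps)
next
  fix x assume "x \<in> A + B"
  then obtain a b where *: "x = a + b" "a \<in> A" "b \<in> B"
    by (auto elim!: set_plus_elim)
  then have "- a + - b \<in> A + B"
    by (intro set_plus_intro add_subgroupD(3)[OF assms(1)] add_subgroupD(3)[OF assms(2)])
  then show "- x \<in> A + B"
    using * by (simp add: algebra_simps)
qed

text \<open>Negation and addition are continuous, so they carry the closures of \<open>S\<close> and
  of \<open>S \<times> S\<close> into \<open>closure S\<close>.\<close>

lemma add_subgroup_closure:
  fixes S :: "'a::{topological_ab_group_add, t2_space} set"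
  assumes S: "add_subgroup S"
  shows "add_subgroup (closure S)"
  unfolding add_subgroup_def
proof (intro conjI ballI)
  show "0 \<in> closure S"
    using add_subgroupD(1)[OF S] closure_subset by blast
next
  fix x assume x: "x \<in> closure S"
  have "uminus ` closure S \<subseteq> closure S"
    by (rule image_closure_subset)
      (use add_subgroupD(3)[OF S] closure_subset[of S] in \<open>auto intro!: continuous_intros\<close>)
  with x show "- x \<in> closure S" by blast
next
  have "(\<lambda>z. fst z + snd z) ` closure (S \<times> S) \<subseteq> closure S"
    by (rule image_closure_subset)
      (use add_subgroupD(2)[OF S] closure_subset[of S] in \<open>auto intro!: continuous_intros\<close>)
  then show "x + y \<in> closure S" if "x \<in> closure S" "y \<in> closure S" for x y
    using that by (force simp: closure_Times)
qed

section \<open>The projections onto the primary components\<close>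

text \<open>Factorials are cofinal for divisibility: every \<open>m > 0\<close> divides
  \<open>fact k\<close> for all \<open>k \<ge> m\<close>. Existence of the limit is shown in
  \<open>tendsto_primary_proj\<close>.\<close>

definition primary_proj :: "nat \<Rightarrow> 'a::{topological_ab_group_add, t2_space} \<Rightarrow> 'a" where
  "primary_proj p x = lim (\<lambda>k. iterate_add (crt_unit p (fact k)) x)"

lemma eq_0_if_in_open_subgroups:
  fixes d :: "'a::{topological_ab_group_add, t2_space}"
  assumes lc: "locally_compact_space (euclidean :: 'a topology)"
    and td: "totally_disconnected (UNIV :: 'a set)"
    and "\<And>U. open U \<Longrightarrow> add_subgroup U \<Longrightarrow> d \<in> U"
  shows "d = 0"
proof (rule ccontr)
  assume "d \<noteq> 0"
  then obtain U where "open U" "add_subgroup U" "U \<subseteq> - {d}"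
    using van_Dantzig[OF lc td, of "- {d}"] by auto
  then show False
    using assms(3) by blast
qed

context
  assumes lc: "locally_compact_space (euclidean :: 'a::{topological_ab_group_add, t2_space} topology)"
    and per: "periodic (UNIV :: 'a set)"
begin

lemma totally_disconnected_UNIV: "totally_disconnected (UNIV :: 'a set)"
  using per by (simp add: periodic_def)

lemma compact_subgroup_cover:
  obtains K where "compact K" "add_subgroup K" "(x::'a) \<in> K"
  using per unfolding periodic_def by blast

text \<open>Quotients of a periodic group by open subgroups are torsion groups. The exponent
  \<open>m\<close> depends on \<open>x\<close> as well as on \<open>U\<close>.\<close>

lemma torsion_mod_open_subgroup:
  assumes "open U" "add_subgroup U"
  obtains m where "m > 0" "iterate_add m (x::'a) \<in> U"
  using compact_subgroup_cover[of x] multiple_in_open_subgroup[OF _ _ _ assms] by metis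

text \<open>Cosets of open subgroups form a neighbourhood base: apply \<open>van_Dantzig\<close> to
  \<open>S\<close> translated to 0.\<close>

lemma small_open_subgroup:
  assumes "open S" "(y::'a) \<in> S"
  obtains U where "open U" "add_subgroup U" "\<And>z. z - y \<in> U \<Longrightarrow> z \<in> S"
proof -
  have "open {z. z - (- y) \<in> S}"
    by (rule open_translate) fact
  then obtain U where "open U" "add_subgroup U" "U \<subseteq> {z. z - (- y) \<in> S}"
    using van_Dantzig[OF lc totally_disconnected_UNIV, of "{z. z - (- y) \<in> S}"] assms(2) by auto
  then show thesis
    by (intro that[of U]) auto
qed

text \<open>Since \<open>m\<close> divides \<open>fact k\<close>, the approximating sequence is
  constant modulo \<open>U\<close> from index \<open>m\<close> on.\<close>

lemma crt_unit_fact_mod_open_subgroup: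
  fixes x :: 'a
  assumes "add_subgroup U" "m > 0" "iterate_add m x \<in> U" "prime p" "k \<ge> m"
  shows "iterate_add (crt_unit p (fact k)) x - iterate_add (crt_unit p m) x \<in> U"
  using assms by (intro iterate_add_cong[of _ m] crt_unit_cong) (auto simp: dvd_fact)

text \<open>A compact subgroup containing \<open>x\<close> supplies a cluster point. The sequence is
  eventually constant modulo every open subgroup, so it converges to that point.\<close>

lemma tendsto_primary_proj:
  assumes "prime p"
  shows "(\<lambda>k. iterate_add (crt_unit p (fact k)) x) \<longlonglongrightarrow> primary_proj p (x::'a)"
proof -
  let ?f = "\<lambda>k. iterate_add (crt_unit p (fact k)) x"
  obtain K where K: "compact K" "add_subgroup K" "x \<in> K"
    by (rule compact_subgroup_cover)
  obtain y where y: "\<And>T N. open T \<Longrightarrow> y \<in> T \<Longrightarrow> \<exists>n\<ge>N. ?f n \<in> T"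
    using compact_imp_cluster_point[OF K(1), of ?f] add_subgroup_iterate_add[OF K(2,3)] by metis
  have "?f \<longlonglongrightarrow> y"
  proof (rule topological_tendstoI)
    fix S assume "open S" "y \<in> S"
    then obtain U where U: "open U" "add_subgroup U" "\<And>z. z - y \<in> U \<Longrightarrow> z \<in> S"
      by (rule small_open_subgroup) blast
    obtain m where m: "m > 0" "iterate_add m x \<in> U"
      using torsion_mod_open_subgroup[OF U(1,2)] by blast
    \<comment> \<open>With \<open>n\<close> beyond \<open>m\<close>, the term at \<open>n\<close> is
      close to \<open>y\<close> and has the same class modulo \<open>U\<close> as every later
      term.\<close>
    obtain n where n: "n \<ge> m" "?f n - y \<in> U"
      using y[OF open_translate[OF U(1), of y], of m] add_subgroupD(1)[OF U(2)] by auto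
    show "eventually (\<lambda>k. ?f k \<in> S) sequentially"
      unfolding eventually_sequentially
    proof (intro exI allI impI)
      fix k assume k: "k \<ge> m"
      note D = crt_unit_fact_mod_open_subgroup[OF U(2) m assms]
      have "(?f k - iterate_add (crt_unit p m) x) - (?f n - iterate_add (crt_unit p m) x) + (?f n - y) \<in> U"
        by (intro add_subgroupD[OF U(2)] D k n)
      then show "?f k \<in> S"
        by (intro U(3)) simp
    qed
  qed
  then show ?thesis
    unfolding primary_proj_def by (simp add: limI)
qed

text \<open>All approximants are multiples of \<open>x\<close>, so neither they nor their limit
  leave \<open>H\<close>.\<close>

lemma primary_proj_in_closed_subgroup:
  assumes "prime p" "closed H" "add_subgroup H" "x \<in> H"
  shows "primary_proj p (x::'a) \<in> H"
  using closed_sequentially[OF assms(2) _ tendsto_primary_proj[OF assms(1)]]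
    add_subgroup_iterate_add[OF assms(3,4)] by blast

text \<open>Open subgroups are closed, so the congruence of the approximants passes to the limit.
  Modulo \<open>U\<close> the projection of \<open>x\<close> is thus an integer multiple of
  \<open>x\<close>.\<close>

lemma primary_proj_mod_open_subgroup:
  fixes x :: 'a
  assumes U: "open U" "add_subgroup U" and m: "m > 0" "iterate_add m x \<in> U" and p: "prime p"
  shows "primary_proj p x - iterate_add (crt_unit p m) x \<in> U"
proof (rule Lim_in_closed_set[OF open_subgroup_imp_closed[OF U]])
  show "eventually (\<lambda>k. iterate_add (crt_unit p (fact k)) x - iterate_add (crt_unit p m) x \<in> U) sequentially"
    using crt_unit_fact_mod_open_subgroup[OF U(2) m p] by (auto simp: eventually_sequentially)
  have "(\<lambda>k. iterate_add (crt_unit p (fact k)) x + - iterate_add (crt_unit p m) x)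
      \<longlonglongrightarrow> primary_proj p x + - iterate_add (crt_unit p m) x"
    by (intro tendsto_add tendsto_primary_proj p tendsto_const)
  then show "(\<lambda>k. iterate_add (crt_unit p (fact k)) x - iterate_add (crt_unit p m) x)
      \<longlonglongrightarrow> primary_proj p x - iterate_add (crt_unit p m) x"
    by simp
qed simp

lemma primary_proj_add:
  assumes "prime p"
  shows "primary_proj p (x + y) = primary_proj p x + primary_proj p (y::'a)"
proof (rule LIMSEQ_unique[OF tendsto_primary_proj[OF assms]])
  show "(\<lambda>k. iterate_add (crt_unit p (fact k)) (x + y)) \<longlonglongrightarrow> primary_proj p x + primary_proj p y"
    unfolding iterate_add_plus by (intro tendsto_add tendsto_primary_proj assms)
qed

text \<open>The map is additive and sends each open subgroup, being closed, into itself.\<close>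

lemma continuous_on_primary_proj:
  assumes "prime p"
  shows "continuous_on S (primary_proj p :: 'a \<Rightarrow> 'a)"
proof -
  have "continuous_on UNIV (primary_proj p :: 'a \<Rightarrow> 'a)"
    unfolding continuous_on_topological
  proof safe
    fix x :: 'a and B assume "open B" "primary_proj p x \<in> B"
    then obtain U where U: "open U" "add_subgroup U" "\<And>z. z - primary_proj p x \<in> U \<Longrightarrow> z \<in> B"
      by (rule small_open_subgroup) blast
    have "primary_proj p y \<in> B" if "y - x \<in> U" for y
    proof (rule U(3))
      have "primary_proj p (y - x) + primary_proj p x = primary_proj p y"
        by (simp flip: primary_proj_add[OF assms])
      moreover have "primary_proj p (y - x) \<in> U"
        using primary_proj_in_closed_subgroup[OF assms open_subgroup_imp_closed U(2)] U that by blast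
      ultimately show "primary_proj p y - primary_proj p x \<in> U"
        by (metis add_diff_cancel_right')
    qed
    then show "\<exists>A. open A \<and> x \<in> A \<and> (\<forall>y\<in>UNIV. y \<in> A \<longrightarrow> primary_proj p y \<in> B)"
      using open_translate[OF U(1), of x] add_subgroupD(1)[OF U(2)]
      by (intro exI[of _ "{y. y - x \<in> U}"]) auto
  qed
  then show ?thesis
    by (rule continuous_on_subset) simp
qed

text \<open>Modulo \<open>U\<close> the projection is \<open>crt_unit p m\<close> times
  \<open>x\<close>; multiplied by \<open>p ^ j\<close> with \<open>j \<ge> multiplicity p m\<close>,
  the coefficient becomes a multiple of \<open>m\<close>.\<close>

lemma primary_proj_in_primary_component:
  assumes p: "prime p"
  shows "primary_proj p (x::'a) \<in> primary_component p"
proof -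
  have "(\<lambda>j. iterate_add (p ^ j) (primary_proj p x)) \<longlonglongrightarrow> 0"
  proof (rule topological_tendstoI)
    fix S :: "'a set" assume "open S" "0 \<in> S"
    then obtain U where U: "open U" "add_subgroup U" "\<And>z. z - 0 \<in> U \<Longrightarrow> z \<in> S"
      by (rule small_open_subgroup) blast
    obtain m where m: "m > 0" "iterate_add m x \<in> U"
      using torsion_mod_open_subgroup[OF U(1,2)] by blast
    show "eventually (\<lambda>j. iterate_add (p ^ j) (primary_proj p x) \<in> S) sequentially"
      unfolding eventually_sequentially
    proof (intro exI allI impI)
      fix j assume j: "j \<ge> multiplicity p m"
      have "iterate_add (p ^ j) (primary_proj p x - iterate_add (crt_unit p m) x) \<in> U"
        by (intro add_subgroup_iterate_add[OF U(2)] primary_proj_mod_open_subgroup U m p)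
      moreover have "iterate_add (p ^ j) (iterate_add (crt_unit p m) x) \<in> U"
      proof -
        obtain l where "p ^ j * crt_unit p m = l * m"
          using dvd_power_mult_crt_unit[OF p m(1) j] by (metis dvdE mult.commute)
        then show ?thesis
          by (metis add_subgroup_iterate_add[OF U(2) m(2)] iterate_add_mult)
      qed
      ultimately have "iterate_add (p ^ j) (primary_proj p x - iterate_add (crt_unit p m) x)
          + iterate_add (p ^ j) (iterate_add (crt_unit p m) x) \<in> U"
        by (rule add_subgroupD(2)[OF U(2)])
      then show "iterate_add (p ^ j) (primary_proj p x) \<in> S"
        by (intro U(3)) (simp flip: iterate_add_plus)
    qed
  qed
  then show ?thesis
    by (simp add: primary_component_def p_element_def)
qed

text \<open>A \<open>p\<close>-element has order dividing some \<open>p ^ a\<close> modulo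
  \<open>U\<close>, and \<open>crt_unit p (p ^ a)\<close> is 1 modulo \<open>p ^ a\<close>. Hence
  the projection fixes it modulo every open subgroup.\<close>

lemma primary_proj_primary_component:
  assumes p: "prime p" and x: "(x::'a) \<in> primary_component p"
  shows "primary_proj p x = x"
proof -
  have "primary_proj p x - x \<in> U" if U: "open U" "add_subgroup U" for U
  proof -
    have "eventually (\<lambda>j. iterate_add (p ^ j) x \<in> U) sequentially"
      using topological_tendstoD[OF _ U(1) add_subgroupD(1)[OF U(2)]] x
      by (simp add: primary_component_def p_element_def)
    then obtain a where a: "iterate_add (p ^ a) x \<in> U"
      by (auto simp: eventually_sequentially)
    have "(primary_proj p x - iterate_add (crt_unit p (p ^ a)) x)
        + (iterate_add (crt_unit p (p ^ a)) x - iterate_add 1 x) \<in> U"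
      using p a prime_gt_0_nat[OF p]
      by (intro add_subgroupD[OF U(2)] primary_proj_mod_open_subgroup U
          iterate_add_cong[OF U(2) a] crt_unit_prime_power) auto
    then show ?thesis
      by simp
  qed
  then have "primary_proj p x - x = 0"
    by (rule eq_0_if_in_open_subgroups[OF lc totally_disconnected_UNIV])
  then show ?thesis
    by simp
qed

text \<open>If \<open>x \<notin> H\<close>, some coset \<open>x + U\<close> misses \<open>H\<close>.
  Yet modulo \<open>U\<close> the element \<open>x\<close> is the finite sum of its projections for
  the primes dividing \<open>m\<close>, and that sum lies in \<open>H\<close>.\<close>

lemma mem_closed_subgroup_if_primary_proj:
  assumes H: "closed H" "add_subgroup H" and x: "\<And>p. prime p \<Longrightarrow> primary_proj p (x::'a) \<in> H"
  shows "x \<in> H"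
proof (rule ccontr)
  assume "x \<notin> H"
  then obtain U where U: "open U" "add_subgroup U" "\<And>z. z - x \<in> U \<Longrightarrow> z \<in> - H"
    using small_open_subgroup[OF open_Compl[OF H(1)], of x] by blast
  obtain m where m: "m > 0" "iterate_add m x \<in> U"
    using torsion_mod_open_subgroup[OF U(1,2)] by blast
  let ?s = "\<Sum>p\<in>prime_factors m. primary_proj p x"
  let ?t = "iterate_add (\<Sum>p\<in>prime_factors m. crt_unit p m) x"
  have "(\<Sum>p\<in>prime_factors m. primary_proj p x - iterate_add (crt_unit p m) x) \<in> U"
    by (intro add_subgroup_sum[OF U(2)] primary_proj_mod_open_subgroup U m) auto
  moreover have "?t - iterate_add 1 x \<in> U"
    by (intro iterate_add_cong[OF U(2) m(2)] sum_crt_unit m(1))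
  ultimately have "(?s - ?t) + (?t - iterate_add 1 x) \<in> U"
    unfolding sum_subtractf iterate_add_sum by (rule add_subgroupD(2)[OF U(2)])
  then have "?s \<in> - H"
    by (intro U(3)) simp
  moreover have "?s \<in> H"
    by (intro add_subgroup_sum[OF H(2)] x) auto
  ultimately show False
    by simp
qed

text \<open>It is the fixed point set of a continuous map on a Hausdorff space.\<close>

lemma closed_primary_component:
  assumes "prime p"
  shows "closed (primary_component p :: 'a set)"
proof -
  have "primary_component p = {x :: 'a. primary_proj p x = x}"
    using primary_proj_in_primary_component[OF assms] primary_proj_primary_component[OF assms]
    by (metis (mono_tags, lifting) Collect_cong Collect_mem_eq)
  then show ?thesis
    using closed_Collect_eq[OF continuous_on_primary_proj[OF assms] continuous_on_id] by simp
qed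

section \<open>Closed subgroups and joins inside a primary component\<close>

lemma closed_subgroup_of_primary_component:
  assumes "prime p"
  shows "closed_subgroup_of (primary_component p) (A :: 'a set) \<longleftrightarrow>
    closed A \<and> add_subgroup A \<and> A \<subseteq> primary_component p"
  using closedin_closed_eq[OF closed_primary_component[OF assms]]
  by (auto simp: closed_subgroup_of_def)

lemma closed_join_primary_component:
  assumes p: "prime p" and AB: "A \<subseteq> primary_component p" "B \<subseteq> primary_component p"
  shows "closed_join (primary_component p) A B = closure (A + B :: 'a set)"
proof -
  have "A + B \<subseteq> primary_component p"
    using AB add_subgroupD(2)[OF add_subgroup_primary_component[of p]] by (auto elim!: set_plus_elim)
  moreover from this have "closure (A + B) \<subseteq> primary_component p"
    by (rule closure_minimal) (rule closed_primary_component[OF p])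
  ultimately show ?thesis
    unfolding closed_join_def closure_of_subtopology by (auto simp: Int_absorb1)
qed

lemma closure_plus_mono: "A \<subseteq> C \<Longrightarrow> B \<subseteq> D \<Longrightarrow> closure (A + B) \<subseteq> closure (C + D :: 'a set)"
  by (intro closure_mono set_plus_mono2)

text \<open>The projection is additive and maps \<open>A\<close> and \<open>B\<close> into their own
  \<open>p\<close>-parts; continuity extends this from \<open>A + B\<close> to its closure.\<close>

lemma primary_proj_closure_plus:
  assumes p: "prime p" and A: "closed A" "add_subgroup A" and B: "closed B" "add_subgroup B"
    and x: "(x::'a) \<in> closure (A + B)"
  shows "primary_proj p x \<in> closure (A \<inter> primary_component p + B \<inter> primary_component p)"
proof -
  have "primary_proj p ` closure (A + B) \<subseteq> closure (A \<inter> primary_component p + B \<inter> primary_component p)"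
  proof (rule image_closure_subset)
    show "primary_proj p ` (A + B) \<subseteq> closure (A \<inter> primary_component p + B \<inter> primary_component p)"
    proof safe
      fix z assume "z \<in> A + B"
      then obtain a b where ab: "z = a + b" "a \<in> A" "b \<in> B"
        by (rule set_plus_elim)
      have "primary_proj p a + primary_proj p b \<in> A \<inter> primary_component p + B \<inter> primary_component p"
        by (intro set_plus_intro IntI primary_proj_in_closed_subgroup primary_proj_in_primary_component
            p A B ab)
      then show "primary_proj p z \<in> closure (A \<inter> primary_component p + B \<inter> primary_component p)"
        using closure_subset by (auto simp: ab(1) primary_proj_add[OF p])
    qed
  qed (auto intro: continuous_on_primary_proj[OF p])
  with x show ?thesis
    by blast
qed

lemma topologically_modular_primary_component:
  assumes mod: "topologically_modular (UNIV :: 'a set)" and p: "prime p"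
  shows "topologically_modular (primary_component p :: 'a set)"
  unfolding topologically_modular_def closed_subgroup_of_primary_component[OF p]
proof (intro allI impI, elim conjE)
  fix A B C :: "'a set"
  assume *: "closed A" "add_subgroup A" "A \<subseteq> primary_component p"
    "closed B" "add_subgroup B" "B \<subseteq> primary_component p"
    "closed C" "add_subgroup C" "C \<subseteq> primary_component p" "A \<subseteq> C"
  \<comment> \<open>Joins of closed subgroups of the component are the same whether formed there or
    in the whole group, so the law is inherited.\<close>
  have "closed_join (primary_component p) A (B \<inter> C) = closed_join UNIV A (B \<inter> C)"
    "closed_join (primary_component p) A B = closed_join UNIV A B"
    using * by (simp_all add: closed_join_UNIV closed_join_primary_component[OF p] le_infI1)
  then show "closed_join (primary_component p) A (B \<inter> C) = closed_join (primary_component p) A B \<inter> C"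
    using mod * unfolding topologically_modular_def closed_subgroup_of_UNIV by simp
qed

lemma topologically_modular_UNIV:
  assumes mod: "\<And>p. prime p \<Longrightarrow> topologically_modular (primary_component p :: 'a set)"
  shows "topologically_modular (UNIV :: 'a set)"
  unfolding topologically_modular_def closed_subgroup_of_UNIV closed_join_UNIV
proof (intro allI impI, elim conjE)
  fix A B C :: "'a set"
  assume A: "add_subgroup A" "closed A" and B: "add_subgroup B" "closed B"
    and C: "add_subgroup C" "closed C" and "A \<subseteq> C"
  show "closure (A + (B \<inter> C)) = closure (A + B) \<inter> C"
  proof
    have "A + (B \<inter> C) \<subseteq> C"
      using \<open>A \<subseteq> C\<close> add_subgroupD(2)[OF C(1)] by (auto elim!: set_plus_elim)
    then have "closure (A + (B \<inter> C)) \<subseteq> C"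
      using C(2) by (rule closure_minimal)
    then show "closure (A + (B \<inter> C)) \<subseteq> closure (A + B) \<inter> C"
      using closure_plus_mono[of A A "B \<inter> C" B] by auto
  next
    show "closure (A + B) \<inter> C \<subseteq> closure (A + (B \<inter> C))"
    proof
      fix x assume x: "x \<in> closure (A + B) \<inter> C"
      show "x \<in> closure (A + (B \<inter> C))"
      \<comment> \<open>Only this inclusion needs the hypothesis on the components; it is checked on
        one projection of \<open>x\<close> at a time.\<close>
      proof (rule mem_closed_subgroup_if_primary_proj)
        show "closed (closure (A + (B \<inter> C)))"
          by simp
        show "add_subgroup (closure (A + (B \<inter> C)))"
          by (intro add_subgroup_closure add_subgroup_plus add_subgroup_Int A B C)
        fix p :: nat assume p: "prime p"
        let ?G = "primary_component p :: 'a set"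
        have sub: "closed_subgroup_of ?G (H \<inter> ?G)" if "add_subgroup H" "closed H" for H
          using that add_subgroup_primary_component closed_primary_component[OF p]
          unfolding closed_subgroup_of_primary_component[OF p] by (auto intro: add_subgroup_Int)
        have "closed_join ?G (A \<inter> ?G) ((B \<inter> ?G) \<inter> (C \<inter> ?G))
            = closed_join ?G (A \<inter> ?G) (B \<inter> ?G) \<inter> (C \<inter> ?G)"
          using mod[OF p] sub[OF A] sub[OF B] sub[OF C] \<open>A \<subseteq> C\<close>
          unfolding topologically_modular_def by blast
        then have eq: "closure (A \<inter> ?G + (B \<inter> ?G) \<inter> (C \<inter> ?G))
            = closure (A \<inter> ?G + B \<inter> ?G) \<inter> (C \<inter> ?G)"
          by (simp add: closed_join_primary_component[OF p] le_infI1)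
        \<comment> \<open>The projection lies on the right side of \<open>eq\<close>; its left side
          is contained in the closure that has to be reached.\<close>
        have "primary_proj p x \<in> closure (A \<inter> ?G + B \<inter> ?G) \<inter> (C \<inter> ?G)"
          using x p A B C
          by (auto intro: primary_proj_closure_plus primary_proj_in_closed_subgroup
              primary_proj_in_primary_component)
        then show "primary_proj p x \<in> closure (A + (B \<inter> C))"
          using eq closure_plus_mono[of "A \<inter> ?G" A "(B \<inter> ?G) \<inter> (C \<inter> ?G)" "B \<inter> C"] by blast
      qed
    qed
  qed
qed

end

theorem theorem1p2:
  assumes "locally_compact_space (euclidean :: 'a::{topological_ab_group_add, t2_space} topology)"
    and "periodic (UNIV :: 'a set)"
  shows "topologically_modular (UNIV :: 'a set) \<longleftrightarrow>
    (\<forall>p::nat. prime p \<longrightarrow> topologically_modular (primary_component p :: 'a set))"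
  using topologically_modular_primary_component[OF assms] topologically_modular_UNIV[OF assms]
  by blast

end
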